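(* Let $n\geq 2$ be an integer, and let $\Lambda_1,\Lambda_2,\ldots,\Lambda_{n^2-1}$ be the $n\times n$ Gell-Mann matrices, i.e. traceless Hermitian $n\times n$ complex matrices satisfying $\mathrm{Tr}(\Lambda_i\Lambda_j)=2\delta_{ij}$ for all $i,j\in\{1,\ldots,n^2-1\}$. Let $U_{n\otimes n}$ be the tensor commutation matrix $n\otimes n$. Then $$U_{n\otimes n}=\frac{1}{n}\,I_n\otimes I_n+\frac{1}{2}\sum_{i=1}^{n^2-1}\Lambda_i\otimes\Lambda_i .$$
   Context: $\mathcal{M}_{m\times n}(\mathbb{C})$ denotes the set of $m\times n$ complex matrices, $I_n$ is the $n\times n$ identity matrix, and $\delta_{ij}$ is the Kronecker symbol. For $A=(A^i_j)\in\mathcal{M}_{m\times n}(\mathbb{C})$ and $B\in\mathcal{M}_{p\times r}(\mathbb{C})$, the tensor product $A\otimes B\in\mathcal{M}_{mp\times nr}(\mathbb{C})$ is the Kronecker product, i.e. the block matrix whose $(i,j)$ block is $A^i_jB$. For integers $p,q\geq 2$, the tensor commutation matrix $p\otimes q$ is the permutation matrix $U_{p\otimes q}\in\mathcal{M}_{pq\times pq}(\mathbb{C})$ (with entries 0 and 1) such that $U_{p\otimes q}\cdot(a\otimes b)=b\otimes a$ for all $a\in\mathcal{M}_{p\times 1}(\mathbb{C})$ and $b\in\mathcal{M}_{q\times 1}(\mathbb{C})$. The generalized Gell-Mann matrices (or $n\times n$ Gell-Mann matrices) are the traceless Hermitian $n\times n$ matrices $\Lambda_1,\ldots,\Lambda_{n^2-1}$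 satisfying $\mathrm{Tr}(\Lambda_i\Lambda_j)=2\delta_{ij}$ for all $i,j\in\{1,\ldots,n^2-1\}$. *)

theory Defs
  imports "Jordan_Normal_Form.Schur_Decomposition"
begin

definition kronecker_mat :: "'a :: semiring_0 mat \<Rightarrow> 'a mat \<Rightarrow> 'a mat" (infixl \<open>\<otimes>\<^sub>m\<close> 70) where
  "A \<otimes>\<^sub>m B = mat (dim_row A * dim_row B) (dim_col A * dim_col B)
     (\<lambda>(i, j). A $$ (i div dim_row B, j div dim_col B) * B $$ (i mod dim_row B, j mod dim_col B))"

definition mat_trace :: "'a :: comm_monoid_add mat \<Rightarrow> 'a" where
  "mat_trace A = sum_list (diag_mat A)"

definition hermitian_mat :: "complex mat \<Rightarrow> bool" where
  "hermitian_mat A \<longleftrightarrow> mat_adjoint A = A"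

definition permutation_mat :: "nat \<Rightarrow> 'a :: zero_neq_one mat \<Rightarrow> bool" where
  "permutation_mat n P \<longleftrightarrow> P \<in> carrier_mat n n
     \<and> (\<forall>i<n. \<forall>j<n. P $$ (i, j) \<in> {0, 1})
     \<and> (\<forall>i<n. \<exists>!j. j < n \<and> P $$ (i, j) = 1)
     \<and> (\<forall>j<n. \<exists>!i. i < n \<and> P $$ (i, j) = 1)"

definition is_tensor_commutation_mat :: "nat \<Rightarrow> nat \<Rightarrow> complex mat \<Rightarrow> bool" where
  "is_tensor_commutation_mat p q U \<longleftrightarrow> permutation_mat (p * q) U
     \<and> (\<forall>a\<in>carrier_mat p 1. \<forall>b\<in>carrier_mat q 1. U * (a \<otimes>\<^sub>m b) = b \<otimes>\<^sub>m a)"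

text \<open>The description is well defined: see \<open>ex1_tensor_commutation_mat\<close> below.\<close>

definition tensor_commutation_mat :: "nat \<Rightarrow> nat \<Rightarrow> complex mat" where
  "tensor_commutation_mat p q = (THE U. is_tensor_commutation_mat p q U)"

text \<open>The family is indexed by \<open>1, \<dots>, n\<^sup>2 - 1\<close>; its values at other indices are irrelevant.\<close>

definition gell_mann_mats :: "nat \<Rightarrow> (nat \<Rightarrow> complex mat) \<Rightarrow> bool" where
  "gell_mann_mats n \<Lambda> \<longleftrightarrow>
     (\<forall>i\<in>{1..n\<^sup>2 - 1}. \<Lambda> i \<in> carrier_mat n n \<and> hermitian_mat (\<Lambda> i) \<and> mat_trace (\<Lambda> i) = 0)
     \<and> (\<forall>i\<in>{1..n\<^sup>2 - 1}. \<forall>j\<in>{1..n\<^sup>2 - 1}. mat_trace (\<Lambda> i * \<Lambda> j) = (if i = j then 2 else 0))"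

text \<open>Finite sum of \<open>nr \<times> nc\<close> matrices, as \<^const>\<open>finsum_vec\<close> is for vectors. It is meaningful when
  every summand lies in \<^term>\<open>carrier_mat nr nc\<close>.\<close>

definition finsum_mat :: "nat \<Rightarrow> nat \<Rightarrow> ('i \<Rightarrow> 'a :: semiring_1 mat) \<Rightarrow> 'i set \<Rightarrow> 'a mat" where
  "finsum_mat nr nc = finsum (module_mat TYPE('a) nr nc)"

lemma index_mult_single_col:
  fixes U :: "'a :: semiring_1 mat"
  assumes U: "U \<in> carrier_mat m n" and r: "r < m" and c: "c < n"
  shows "(U * mat n 1 (\<lambda>(i, j). if i = c then 1 else 0)) $$ (r, 0) = U $$ (r, c)"
proof -
  have "(U * mat n 1 (\<lambda>(i, j). if i = c then 1 else 0)) $$ (r, 0)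
      = (\<Sum>i = 0..<n. if i = c then U $$ (r, i) else 0)"
    using U r by (simp add: scalar_prod_def if_distrib[of "(*) _"] cong: if_cong)
  also have "\<dots> = U $$ (r, c)" using c by simp
  finally show ?thesis .
qed

lemma kronecker_single_col:
  assumes c: "c < p * q"
  shows "mat p 1 (\<lambda>(i, j). if i = c div q then 1 else 0) \<otimes>\<^sub>m
         mat q 1 (\<lambda>(i, j). if i = c mod q then 1 else 0)
       = mat (p * q) 1 (\<lambda>(i, j). if i = c then 1 else (0 :: 'a :: semiring_1))"
proof (rule eq_matI, goal_cases)
  case (1 i j)
  then have "0 < q" "i < p * q" by (auto intro: Nat.gr0I)
  moreover from this have "i div q < p" by (simp add: less_mult_imp_div_less)
  moreover have "i = c" if "i div q = c div q" "i mod q = c mod q"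
    using that by (metis div_mult_mod_eq)
  ultimately show ?case using 1 by (auto simp: kronecker_mat_def)
qed (auto simp: kronecker_mat_def)

lemma is_tensor_commutation_mat_unique:
  assumes "is_tensor_commutation_mat p q U" "is_tensor_commutation_mat p q V"
  shows "U = V"
proof -
  have carrier: "U \<in> carrier_mat (p * q) (p * q)" "V \<in> carrier_mat (p * q) (p * q)"
    using assms by (auto simp: is_tensor_commutation_mat_def permutation_mat_def)
  have "U $$ (r, c) = V $$ (r, c)" if r: "r < p * q" and c: "c < p * q" for r c
  proof -
    let ?a = "mat p 1 (\<lambda>(i, j). if i = c div q then 1 else 0) :: complex mat"
    let ?b = "mat q 1 (\<lambda>(i, j). if i = c mod q then 1 else 0) :: complex mat"
    have "U * (?a \<otimes>\<^sub>m ?b) = V * (?a \<otimes>\<^sub>m ?b)"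
      using assms by (simp add: is_tensor_commutation_mat_def)
    then show ?thesis
      unfolding kronecker_single_col[OF c]
      using index_mult_single_col[OF carrier(1) r c] index_mult_single_col[OF carrier(2) r c] by simp
  qed
  then show ?thesis using carrier by (intro eq_matI) auto
qed

lemma swap_index:
  fixes p q r :: nat
  assumes "r < p * q"
  shows "(r mod p) * q + r div p < p * q"
    and "((r mod p) * q + r div p) div q = r mod p"
    and "((r mod p) * q + r div p) mod q = r div p"
proof -
  have p: "0 < p" using assms by (auto intro: Nat.gr0I)
  then have m: "r mod p < p" by simp
  have d: "r div p < q" using assms by (simp add: less_mult_imp_div_less mult.commute)
  have "(r mod p) * q + r div p < (r mod p) * q + q" using d by simp
  also have "\<dots> = Suc (r mod p) * q" by simp
  also have "\<dots> \<le> p * q" using m by (intro mult_le_mono1) simp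
  finally show "(r mod p) * q + r div p < p * q" .
  show "((r mod p) * q + r div p) div q = r mod p" "((r mod p) * q + r div p) mod q = r div p"
    using d by simp_all
qed

lemma is_tensor_commutation_mat_witness:
  "is_tensor_commutation_mat p q
     (mat (p * q) (p * q) (\<lambda>(r, c). if c = (r mod p) * q + r div p then 1 else 0))"
    (is "is_tensor_commutation_mat p q ?U")
proof -
  have col: "\<exists>!r. r < p * q \<and> c = (r mod p) * q + r div p" if c: "c < p * q" for c
  proof
    have "c < q * p" using c by (simp add: mult.commute)
    from swap_index[OF this]
    show "(c mod q) * p + c div q < p * q \<and>
        c = ((c mod q) * p + c div q) mod p * q + ((c mod q) * p + c div q) div p"
      by (simp add: mult.commute)
  next
    fix r assume r: "r < p * q \<and> c = (r mod p) * q + r div p"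
    with swap_index[of r p q] show "r = (c mod q) * p + c div q" by simp
  qed
  have perm: "permutation_mat (p * q) ?U"
    unfolding permutation_mat_def
  proof (intro conjI allI impI)
    fix i assume i: "i < p * q"
    have "(j < p * q \<and> ?U $$ (i, j) = 1) = (j = (i mod p) * q + i div p)" for j
      using i swap_index(1)[OF i]
      by (cases "j = (i mod p) * q + i div p") simp_all
    then show "\<exists>!j. j < p * q \<and> ?U $$ (i, j) = 1" by simp
  next
    fix j assume j: "j < p * q"
    have "(i < p * q \<and> ?U $$ (i, j) = 1) = (i < p * q \<and> j = (i mod p) * q + i div p)" for i
      using j by (cases "j = (i mod p) * q + i div p") auto
    then show "\<exists>!i. i < p * q \<and> ?U $$ (i, j) = 1" using col[OF j] by simp
  qed auto
  have "?U * (a \<otimes>\<^sub>m b) = b \<otimes>\<^sub>m a" if a: "a \<in> carrier_mat p 1" and b: "b \<in> carrier_mat q 1" for a b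
  proof (rule eq_matI, goal_cases)
    case (1 r j)
    then have r: "r < p * q" and j: "j = 0"
      using a b by (auto simp: kronecker_mat_def mult.commute)
    let ?s = "(r mod p) * q + r div p"
    note s = swap_index[OF r]
    define M where "M = a \<otimes>\<^sub>m b"
    have M: "M \<in> carrier_mat (p * q) 1" using a b by (auto simp: M_def kronecker_mat_def)
    have "(?U * M) $$ (r, j) = (\<Sum>i = 0..<p * q. (if i = ?s then 1 else 0) * M $$ (i, 0))"
      using r j M by (simp add: scalar_prod_def)
    also have "\<dots> = (\<Sum>i = 0..<p * q. if i = ?s then M $$ (i, 0) else 0)"
      by (rule sum.cong[OF refl]) simp
    also have "\<dots> = M $$ (?s, 0)" using s(1) by simp
    also have "\<dots> = (b \<otimes>\<^sub>m a) $$ (r, j)"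
      using a b r j s by (simp add: M_def kronecker_mat_def mult.commute[of q p] mult.commute[of "b $$ _"])
    finally show ?case by (simp add: M_def)
  qed (use that in \<open>auto simp: kronecker_mat_def\<close>)
  with perm show ?thesis by (simp add: is_tensor_commutation_mat_def)
qed

lemma ex1_tensor_commutation_mat: "\<exists>!U. is_tensor_commutation_mat p q U"
  using is_tensor_commutation_mat_witness is_tensor_commutation_mat_unique by blast

lemma is_tensor_commutation_mat_tensor_commutation_mat:
  "is_tensor_commutation_mat p q (tensor_commutation_mat p q)"
  unfolding tensor_commutation_mat_def by (rule theI'[OF ex1_tensor_commutation_mat])

lemma index_finsum_mat:
  fixes f :: "'i \<Rightarrow> 'a :: comm_ring_1 mat"
  assumes "finite S" and "\<And>i. i \<in> S \<Longrightarrow> f i \<in> carrier_mat nr nc"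
  shows "finsum_mat nr nc f S \<in> carrier_mat nr nc
    \<and> (\<forall>r<nr. \<forall>c<nc. finsum_mat nr nc f S $$ (r, c) = (\<Sum>i\<in>S. f i $$ (r, c)))"
proof -
  interpret M: abelian_group "module_mat TYPE('a) nr nc" by (rule abelian_group_mat)
  from assms show ?thesis
  proof (induction S rule: finite_induct)
    case empty
    then show ?case by (simp add: finsum_mat_def module_mat_simps)
  next
    case (insert i S)
    have "finsum_mat nr nc f (insert i S) = f i + finsum_mat nr nc f S"
      using insert.hyps insert.prems unfolding finsum_mat_def
      by (subst M.finsum_insert) (auto simp: module_mat_simps)
    with insert show ?case by (auto simp: carrier_matD)
  qed
qed

end

theory Submission
  imports Defs
begin

text \<open>The matrices \<open>I, \<Lambda>\<^sub>1, \<dots>\<close> and \<open>I/n, \<Lambda>\<^sub>1/2, \<dots>\<close> are dual families of \<open>n\<^sup>2\<close> matrices for the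
  trace form. Flattening each matrix to a vector of length \<open>n\<^sup>2\<close>, this duality says that two square
  matrices of size \<open>n\<^sup>2\<close> have product \<open>I\<close>; the product in the other order is then also \<open>I\<close>, and its
  entries are exactly those of the claimed identity.\<close>

lemma sum_lessThan_mult_div_mod:
  fixes f :: "nat \<Rightarrow> nat \<Rightarrow> 'a :: comm_monoid_add"
  shows "(\<Sum>c<m * n. f (c div n) (c mod n)) = (\<Sum>a<m. \<Sum>b<n. f a b)"
proof -
  have "(\<Sum>a<m. \<Sum>b<n. f a b) = (\<Sum>(a, b)\<in>{..<m} \<times> {..<n}. f a b)"
    by (rule sum.cartesian_product)
  also have "\<dots> = (\<Sum>c<m * n. f (c div n) (c mod n))"
  proof (rule sum.reindex_bij_witness[where
        i = "\<lambda>c. (c div n, c mod n)" and j = "\<lambda>(a, b). a * n + b"], goal_cases)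
    case (2 x)
    obtain a b where "x = (a, b)" "a < m" "b < n" using 2 by auto
    moreover have "a * n + b < Suc a * n" using \<open>b < n\<close> by simp
    moreover have "Suc a * n \<le> m * n" using \<open>a < m\<close> by (intro mult_le_mono1) simp
    ultimately show ?case by simp
  next
    case (4 c)
    then have "0 < n" by (auto intro: Nat.gr0I)
    with 4 show ?case by (simp add: less_mult_imp_div_less)
  qed auto
  finally show ?thesis by simp
qed

lemma mat_trace_mult:
  assumes "A \<in> carrier_mat n m" "B \<in> carrier_mat m n"
  shows "mat_trace (A * B) = (\<Sum>a<n. \<Sum>b<m. A $$ (a, b) * B $$ (b, a))"
  using assms
  by (simp add: mat_trace_def diag_mat_def scalar_prod_def interv_sum_list_conv_sum_set_nat
      atLeast0LessThan)

text \<open>Since \<open>n * n\<close> is the dimension of the space of matrices, two families of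
  that size which are dual for the trace form are dual bases. The conclusion is their completeness
  relation, read entry by entry.\<close>

lemma trace_dual_completeness:
  fixes A B :: "nat \<Rightarrow> 'a :: field mat"
  assumes A: "\<And>k. k < n * n \<Longrightarrow> A k \<in> carrier_mat n n"
    and B: "\<And>k. k < n * n \<Longrightarrow> B k \<in> carrier_mat n n"
    and dual: "\<And>k l. k < n * n \<Longrightarrow> l < n * n \<Longrightarrow> mat_trace (A k * B l) = (if k = l then 1 else 0)"
    and ij: "i < n" "j < n" and pq: "p < n" "q < n"
  shows "(\<Sum>k<n * n. A k $$ (p, q) * B k $$ (i, j)) = (if p = j \<and> q = i then 1 else 0)"
proof -
  \<comment> \<open>\<open>W\<close> reads each \<open>A k\<close> row by row, \<open>X\<close>
    reads each \<open>B k\<close> column by column. This transposition turns row \<open>k\<close>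
    times column \<open>l\<close> into the trace of \<open>A k * B l\<close>.\<close>
  define W where "W = mat (n * n) (n * n) (\<lambda>(k, c). A k $$ (c div n, c mod n))"
  define X where "X = mat (n * n) (n * n) (\<lambda>(c, k). B k $$ (c mod n, c div n))"
  have W: "W \<in> carrier_mat (n * n) (n * n)" and X: "X \<in> carrier_mat (n * n) (n * n)"
    by (simp_all add: W_def X_def)
  have "W * X = 1\<^sub>m (n * n)"
  proof (rule eq_matI)
    fix k l assume "k < dim_row (1\<^sub>m (n * n) :: 'a mat)" "l < dim_col (1\<^sub>m (n * n) :: 'a mat)"
    then have k: "k < n * n" and l: "l < n * n" by auto
    have "(W * X) $$ (k, l) =
        (\<Sum>c<n * n. A k $$ (c div n, c mod n) * B l $$ (c mod n, c div n))"
      using k l by (simp add: W_def X_def scalar_prod_def atLeast0LessThan)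
    also have "\<dots> = mat_trace (A k * B l)"
      unfolding mat_trace_mult[OF A[OF k] B[OF l]] by (rule sum_lessThan_mult_div_mod)
    finally show "(W * X) $$ (k, l) = 1\<^sub>m (n * n) $$ (k, l)" using k l dual by simp
  qed (simp_all add: W_def X_def)
  \<comment> \<open>Passing to the other order requires \<open>W\<close> and \<open>X\<close> to be
    square, hence exactly \<open>n * n\<close> matrices in each family.\<close>
  then have XW: "X * W = 1\<^sub>m (n * n)" by (rule mat_mult_left_right_inverse[OF W X])
  have lt: "a * n + b < n * n" if "a < n" "b < n" for a b
  proof -
    have "a * n + b < Suc a * n" using that by simp
    also have "\<dots> \<le> n * n" using that by (intro mult_le_mono1) simp
    finally show ?thesis .
  qed
  \<comment> \<open>Row \<open>j * n + i\<close> of \<open>X\<close> holds the entries of the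
    \<open>B k\<close> at \<open>(i, j)\<close>, and column \<open>p * n + q\<close> of
    \<open>W\<close> those of the \<open>A k\<close> at \<open>(p, q)\<close>.\<close>
  have "(\<Sum>k<n * n. A k $$ (p, q) * B k $$ (i, j)) = (X * W) $$ (j * n + i, p * n + q)"
    using ij pq lt[OF ij(2) ij(1)] lt[OF pq]
    by (simp add: W_def X_def scalar_prod_def atLeast0LessThan mult.commute)
  also have "\<dots> = (if j * n + i = p * n + q then 1 else 0)"
    unfolding XW using lt[OF ij(2) ij(1)] lt[OF pq] by simp
  also have "j * n + i = p * n + q \<longleftrightarrow> p = j \<and> q = i"
  proof
    assume eq: "j * n + i = p * n + q"
    have "(j * n + i) div n = (p * n + q) div n" "(j * n + i) mod n = (p * n + q) mod n"
      unfolding eq by simp_all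
    then show "p = j \<and> q = i" using ij pq by simp
  qed simp
  finally show ?thesis .
qed

text \<open>Coordinate \<open>r\<close> of the swapped product has factors \<open>b\<close> at
  \<open>r div p\<close> and \<open>a\<close> at \<open>r mod p\<close>; the unswapped product has
  them at index \<open>(r mod p) * q + r div p\<close>, which locates the single 1 in row
  \<open>r\<close>.\<close>

lemma tensor_commutation_mat_eq:
  "tensor_commutation_mat p q =
    mat (p * q) (p * q) (\<lambda>(r, c). if c = (r mod p) * q + r div p then 1 else 0)"
  using is_tensor_commutation_mat_tensor_commutation_mat is_tensor_commutation_mat_witness
  by (rule is_tensor_commutation_mat_unique)

theorem theorem0p3p2:
  fixes n :: nat and \<Lambda> :: "nat \<Rightarrow> complex mat"
  assumes "n \<ge> 2"
    and "gell_mann_mats n \<Lambda>"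
  shows "tensor_commutation_mat n n =
    (1 / of_nat n) \<cdot>\<^sub>m (1\<^sub>m n \<otimes>\<^sub>m 1\<^sub>m n)
    + (1 / 2) \<cdot>\<^sub>m finsum_mat (n * n) (n * n) (\<lambda>i. \<Lambda> i \<otimes>\<^sub>m \<Lambda> i) {1..n\<^sup>2 - 1}"
proof -
  let ?S = "{1..n\<^sup>2 - 1}"
  let ?F = "finsum_mat (n * n) (n * n) (\<lambda>i. \<Lambda> i \<otimes>\<^sub>m \<Lambda> i) ?S"
  have n: "0 < n" using assms(1) by simp
  have \<Lambda>: "\<Lambda> k \<in> carrier_mat n n" "mat_trace (\<Lambda> k) = 0" if "k \<in> ?S" for k
    using assms(2) that by (auto simp: gell_mann_mats_def)
  have orth: "mat_trace (\<Lambda> k * \<Lambda> l) = (if k = l then 2 else 0)" if "k \<in> ?S" "l \<in> ?S" for k l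
    using assms(2) that by (auto simp: gell_mann_mats_def)
  have kron: "\<Lambda> k \<otimes>\<^sub>m \<Lambda> k \<in> carrier_mat (n * n) (n * n)" if "k \<in> ?S" for k
    using \<Lambda>(1)[OF that] by (auto simp: kronecker_mat_def)
  have F: "?F \<in> carrier_mat (n * n) (n * n)"
    "\<And>r c. r < n * n \<Longrightarrow> c < n * n \<Longrightarrow> ?F $$ (r, c) = (\<Sum>k\<in>?S. (\<Lambda> k \<otimes>\<^sub>m \<Lambda> k) $$ (r, c))"
    using index_finsum_mat[of ?S "\<lambda>i. \<Lambda> i \<otimes>\<^sub>m \<Lambda> i", OF _ kron] by auto
  have split: "{..<n * n} = insert 0 ?S" using n by (auto simp: power2_eq_square)
  have S: "k \<in> ?S" if "k < n * n" "k \<noteq> 0" for k using that by (auto simp: power2_eq_square)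
  \<comment> \<open>The free index 0 is given to the identity, completing the family to
    \<open>n * n\<close> matrices. The weights \<open>d\<close> are the reciprocals of the traces of
    the squares, \<open>n\<close> for the identity and 2 for each \<Lambda>, so that
    \<open>d k\<close> times \<open>A k\<close> gives the dual family.\<close>
  define A where "A k = (if k = 0 then 1\<^sub>m n else \<Lambda> k)" for k
  define d :: "nat \<Rightarrow> complex" where "d k = (if k = 0 then 1 / of_nat n else 1 / 2)" for k
  have A: "A k \<in> carrier_mat n n" if "k < n * n" for k
    using that \<Lambda>(1) S by (auto simp: A_def)
  have trA: "mat_trace (A k * A l) = (if k = l then 1 / d l else 0)"
    if k: "k < n * n" and l: "l < n * n" for k l
  proof -
    have tr1: "mat_trace (1\<^sub>m n :: complex mat) = of_nat n"
      by (simp add: mat_trace_def diag_mat_def interv_sum_list_conv_sum_set_nat)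
    \<comment> \<open>Tracelessness is orthogonality to the identity for the trace form.\<close>
    have one: "mat_trace (1\<^sub>m n * \<Lambda> m) = 0" "mat_trace (\<Lambda> m * 1\<^sub>m n) = 0" if "m \<in> ?S" for m
      using \<Lambda>[OF that] by simp_all
    consider "k = 0" "l = 0" | "k = 0" "l \<noteq> 0" | "k \<noteq> 0" "l = 0" | "k \<noteq> 0" "l \<noteq> 0" by blast
    then show ?thesis
    proof cases
      case 1
      then show ?thesis by (simp add: A_def d_def tr1)
    next
      case 2
      then show ?thesis using one(1)[OF S[OF l]] by (simp add: A_def)
    next
      case 3
      then show ?thesis using one(2)[OF S[OF k]] by (simp add: A_def)
    next
      case 4
      then show ?thesis using orth[OF S[OF k] S[OF l]] by (simp add: A_def d_def)
    qed
  qed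
  have dual: "mat_trace (A k * (d l \<cdot>\<^sub>m A l)) = (if k = l then 1 else 0)"
    if k: "k < n * n" and l: "l < n * n" for k l
  proof -
    have "mat_trace (A k * (d l \<cdot>\<^sub>m A l)) = d l * mat_trace (A k * A l)"
      using A[OF k] A[OF l] by (simp add: mat_trace_mult sum_distrib_left mult_ac)
    then show ?thesis using trA[OF k l] n by (simp add: d_def)
  qed
  show ?thesis
    unfolding tensor_commutation_mat_eq
  proof (rule eq_matI, goal_cases)
    case (1 r c)
    then have r: "r < n * n" and c: "c < n * n" using F(1) by auto
    \<comment> \<open>The quotients locate the block of the Kronecker product, the remainders the
      entry inside it.\<close>
    let ?i = "r div n" and ?p = "r mod n" and ?j = "c div n" and ?q = "c mod n"
    have lt: "?i < n" "?p < n" "?j < n" "?q < n"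
      using r c n by (simp_all add: less_mult_imp_div_less)
    have "((1 / of_nat n) \<cdot>\<^sub>m (1\<^sub>m n \<otimes>\<^sub>m 1\<^sub>m n) + (1 / 2) \<cdot>\<^sub>m ?F) $$ (r, c) =
        1 / of_nat n * (1\<^sub>m n $$ (?i, ?j) * 1\<^sub>m n $$ (?p, ?q))
        + 1 / 2 * (\<Sum>k\<in>?S. \<Lambda> k $$ (?i, ?j) * \<Lambda> k $$ (?p, ?q))"
    proof -
      have "(\<Lambda> k \<otimes>\<^sub>m \<Lambda> k) $$ (r, c) = \<Lambda> k $$ (?i, ?j) * \<Lambda> k $$ (?p, ?q)" if "k \<in> ?S" for k
        using \<Lambda>(1)[OF that] r c by (simp add: kronecker_mat_def)
      moreover have "(1\<^sub>m n \<otimes>\<^sub>m 1\<^sub>m n) $$ (r, c) = (1\<^sub>m n $$ (?i, ?j) * 1\<^sub>m n $$ (?p, ?q) :: complex)"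
        using r c by (simp add: kronecker_mat_def)
      moreover have "(1\<^sub>m n \<otimes>\<^sub>m 1\<^sub>m n :: complex mat) \<in> carrier_mat (n * n) (n * n)"
        by (auto simp: kronecker_mat_def)
      ultimately show ?thesis
        using F r c by (simp del: index_one_mat(1))
    qed
    \<comment> \<open>The identity part is the term for index 0, and the weights \<open>d\<close>
      absorb the coefficients \<open>1 / n\<close> and \<open>1 / 2\<close>.\<close>
    also have "\<dots> = (\<Sum>k<n * n. A k $$ (?p, ?q) * (d k \<cdot>\<^sub>m A k) $$ (?i, ?j))"
    proof -
      have "(\<Sum>k\<in>?S. A k $$ (?p, ?q) * (d k \<cdot>\<^sub>m A k) $$ (?i, ?j)) =
          (\<Sum>k\<in>?S. 1 / 2 * (\<Lambda> k $$ (?i, ?j) * \<Lambda> k $$ (?p, ?q)))"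
      proof (rule sum.cong[OF refl])
        fix k assume k: "k \<in> ?S"
        then show "A k $$ (?p, ?q) * (d k \<cdot>\<^sub>m A k) $$ (?i, ?j) =
            1 / 2 * (\<Lambda> k $$ (?i, ?j) * \<Lambda> k $$ (?p, ?q))"
          using \<Lambda>(1)[OF k] lt by (simp add: A_def d_def)
      qed
      moreover have "A 0 $$ (?p, ?q) * (d 0 \<cdot>\<^sub>m A 0) $$ (?i, ?j) =
          1 / of_nat n * (1\<^sub>m n $$ (?i, ?j) * 1\<^sub>m n $$ (?p, ?q))"
        using lt by (simp add: A_def d_def)
      ultimately show ?thesis
        unfolding split by (subst sum.insert) (simp_all only: sum_distrib_left, simp_all)
    qed
    also have "\<dots> = (if ?p = ?j \<and> ?q = ?i then 1 else 0)"
      using A dual lt by (intro trace_dual_completeness) auto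
    \<comment> \<open>In base \<open>n\<close>, the digits of \<open>c\<close> are those of
      \<open>r\<close> exchanged, which is where the commutation matrix has its 1.\<close>
    also have "?p = ?j \<and> ?q = ?i \<longleftrightarrow> c = ?p * n + ?i"
      using swap_index[OF r] by (metis div_mult_mod_eq)
    finally show ?case using r c by simp
  qed (use F(1) in auto)
qed

end
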